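(* Let $m$ be an even positive integer and $k > 2$ an integer with $\sigma(m) = km$. Write $k = 2^n t$ with $t$ odd and $n \geq 0$, and $m = 2^{\alpha} h$ with $h$ odd and $\alpha \geq 1$. Then $\operatorname{rad}(m) < m^{\frac{2n + 2\alpha + 1}{2n + 2\alpha + 2}}$.
   Context: $\sigma(m)$ is the sum of the positive divisors of $m$; $\operatorname{rad}(m)$ is the product of the distinct primes dividing $m$. In the paper, $m$ is called multiperfect (with abundancy $k$) if $\sigma(m) = km$ for an integer $k > 2$. *)

theory Defs
  imports Complex_Main "HOL-Computational_Algebra.Primes"
begin

definition sigma :: "nat \<Rightarrow> nat" where
  "sigma m = (\<Sum>d | d dvd m. d)"

definition rad :: "nat \<Rightarrow> nat" where
  "rad m = (\<Prod>p\<in>prime_factors m. p)"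

end

theory Submission
  imports Defs
begin

text \<open>
Put \<open>N = n + \<alpha>\<close> and \<open>Q = m / rad m\<close>; the claim is equivalent to \<open>rad m < Q ^ (2 * N + 1)\<close>.
The primes of exponent at least 2 contribute at most \<open>Q\<close> to the radical. Let \<open>S\<close> be the set of
odd primes of exponent 1. Each \<open>p \<in> S\<close> makes the factor \<open>p + 1\<close> of \<open>\<sigma>(m)\<close> even, so \<open>S\<close> has at most \<open>N\<close>
elements, and it remains to see that they are on average smaller than \<open>Q\<^sup>2\<close>, with a factor 2 to
spare when \<open>\<alpha> = 1\<close>.

Every \<open>p \<in> S\<close> divides \<open>\<sigma>(m)\<close>, hence \<open>\<sigma>(q ^ a)\<close> for some prime power \<open>q ^ a\<close> exactly dividing \<open>m\<close>. If
\<open>q \<in> S\<close> then \<open>2 * p \<le> q + 1\<close>, and one passes to the larger prime \<open>q\<close>. Otherwise \<open>q = 2\<close> or \<open>a \<ge> 2\<close>, and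
\<open>p \<le> \<sigma>(q ^ a)\<close> is compared with \<open>Q\<^sup>2 \<ge> q ^ (2 * (a - 1))\<close>. The comparison fails only for \<open>\<alpha> = 1\<close>,
\<open>Q = q\<close> and \<open>p = q\<^sup>2 + q + 1\<close>; then the remaining elements of \<open>S\<close> are so small that either they
compensate for \<open>p\<close> or \<open>\<sigma>(m) < 3 * m\<close>.
\<close>

section \<open>Multiplicativity of \<open>sigma\<close> and bounds for it at prime powers\<close>

lemma sigma_mult:
  assumes "coprime a b"
  shows "sigma (a * b) = sigma a * sigma b"
proof -
  \<comment> \<open>The gcds with \<open>a\<close> and \<open>b\<close> recover the two factors of a
    divisor of \<open>a * b\<close>; they give the inverse of multiplication on pairs of
    divisors.\<close>
  have gcd_left: "gcd (x * y) a = x" if "x dvd a" "y dvd b" for x y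
  proof -
    have "coprime y a"
      using assms that by (meson coprime_commute coprime_divisors dvd_refl)
    then show ?thesis
      using that by (simp add: gcd_mult_left_right_cancel coprime_commute gcd_nat.absorb1)
  qed
  have gcd_right: "gcd (x * y) b = y" if "x dvd a" "y dvd b" for x y
  proof -
    have "coprime x b"
      using assms that by (meson coprime_divisors dvd_refl)
    then show ?thesis
      using that by (simp add: gcd_mult_left_left_cancel coprime_commute gcd_nat.absorb1)
  qed
  have decomp: "gcd d a dvd a \<and> gcd d b dvd b \<and> gcd d a * gcd d b = d" if d: "d dvd a * b" for d
  proof -
    obtain x y where "d = x * y" "x dvd a" "y dvd b"
      using division_decomp[OF d] by blast
    then show ?thesis
      using gcd_left gcd_right by auto
  qed
  have "sigma a * sigma b = (\<Sum>(x, y)\<in>{x. x dvd a} \<times> {y. y dvd b}. x * y)"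
    unfolding sigma_def sum_product sum.cartesian_product ..
  also have "\<dots> = sigma (a * b)"
    unfolding sigma_def
    by (rule sum.reindex_bij_witness[where i = "\<lambda>d. (gcd d a, gcd d b)" and j = "\<lambda>(x, y). x * y"])
       (use decomp in \<open>auto simp: gcd_left gcd_right mult_dvd_mono\<close>)
  finally show ?thesis ..
qed

lemma sigma_prime_power:
  assumes "prime p"
  shows "sigma (p ^ e) = (\<Sum>i\<le>e. p ^ i)"
proof -
  have "{d. d dvd p ^ e} = (\<lambda>i. p ^ i) ` {..e}"
    using assms by (auto simp: divides_primepow_nat)
  moreover have "inj_on (\<lambda>i. p ^ i) {..e}"
    using prime_gt_1_nat[OF assms] by (auto simp: inj_on_def)
  ultimately show ?thesis
    unfolding sigma_def by (simp add: sum.reindex)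
qed

lemma sigma_prod_prime_powers:
  assumes "finite A" "\<And>p. p \<in> A \<Longrightarrow> prime p"
  shows "sigma (\<Prod>p\<in>A. p ^ e p) = (\<Prod>p\<in>A. sigma (p ^ e p))"
  using assms
proof (induction A rule: finite_induct)
  case empty
  then show ?case by (simp add: sigma_def)
next
  case (insert q A)
  have "coprime (q ^ e q) (\<Prod>p\<in>A. p ^ e p)"
  proof (rule prod_coprime_right)
    fix p assume "p \<in> A"
    then have "prime p" "prime q" "q \<noteq> p"
      using insert by auto
    then show "coprime (q ^ e q) (p ^ e p)"
      by (simp add: primes_coprime)
  qed
  then show ?case
    using insert by (simp add: sigma_mult)
qed

text \<open>The powers of \<open>p\<close> at least double at each step, so by induction the last
  one exceeds the sum of all earlier ones.\<close>

lemma sigma_prime_power_less: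
  assumes "prime p"
  shows "sigma (p ^ e) < 2 * p ^ e"
proof -
  have "2 * p ^ i \<le> p ^ Suc i" for i
    using prime_ge_2_nat[OF assms] by simp
  then have "(\<Sum>i\<le>e. p ^ i) < 2 * p ^ e"
    by (induction e) (auto simp del: power_Suc intro: less_le_trans)
  then show ?thesis
    using assms by (simp add: sigma_prime_power)
qed

lemma sigma_odd_prime_power_less:
  assumes "prime p" "p \<ge> 3"
  shows "2 * sigma (p ^ e) < 3 * p ^ e"
proof -
  have "3 * p ^ i \<le> p ^ Suc i" for i
    using assms by simp
  then have "2 * (\<Sum>i\<le>e. p ^ i) < 3 * p ^ e"
    by (induction e) (auto simp del: power_Suc intro: less_le_trans)
  then show ?thesis
    using assms by (simp add: sigma_prime_power)
qed

lemma sigma_prime_square: "prime p \<Longrightarrow> sigma (p\<^sup>2) = p\<^sup>2 + p + 1"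
  by (simp add: sigma_prime_power atMost_nat_numeral)

lemma sigma_two_power: "sigma (2 ^ e) = 2 ^ (e + 1) - 1"
proof -
  have "(\<Sum>i\<le>e. 2 ^ i) + 1 = (2::nat) ^ (e + 1)"
    by (induction e) auto
  then show ?thesis
    by (simp add: sigma_prime_power)
qed

text \<open>\<open>N\<close> stands for n + \<alpha>. Of the factorisations of \<open>k\<close> and
  \<open>m\<close> only the bound \<open>val_sigma\<close> on the power of 2 in
  \<open>sigma m\<close> is kept.\<close>

locale even_multiperfect =
  fixes m k N :: nat
  assumes m_pos: "m > 0" and even_m: "even m" and k_gt_2: "k > 2"
    and sigma_m: "sigma m = k * m" and val_sigma: "\<not> 2 ^ Suc N dvd sigma m"
begin

section \<open>The prime factors of \<open>m\<close>, split by exponent\<close>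

definition ex :: "nat \<Rightarrow> nat" where "ex p = multiplicity p m"

definition s :: "nat \<Rightarrow> nat" where "s p = sigma (p ^ ex p)"

definition S :: "nat set" where "S = {p \<in> prime_factors m. p \<noteq> 2 \<and> ex p = 1}"

definition A :: "nat set" where "A = {p \<in> prime_factors m. ex p \<ge> 2}"

definition Q :: nat where "Q = (\<Prod>p\<in>prime_factors m. p ^ (ex p - 1))"

lemma ex_pos: "p \<in> prime_factors m \<Longrightarrow> ex p > 0"
  unfolding ex_def by (simp add: prime_factors_multiplicity)

lemma primeI: "p \<in> prime_factors m \<Longrightarrow> prime p"
  by auto

lemma two_in: "2 \<in> prime_factors m"
  using m_pos even_m by (simp add: prime_factors_dvd)

lemma m_eq_prod: "m = (\<Prod>p\<in>prime_factors m. p ^ ex p)"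
  using prime_factorization_nat[OF m_pos] unfolding ex_def .

lemma sigma_m_eq_prod: "sigma m = (\<Prod>p\<in>prime_factors m. s p)"
  unfolding s_def
  by (subst m_eq_prod) (rule sigma_prod_prime_powers; auto)

lemma m_eq: "m = Q * rad m"
proof -
  have "Q * rad m = (\<Prod>p\<in>prime_factors m. p ^ (ex p - 1) * p)"
    unfolding Q_def rad_def by (simp add: prod.distrib)
  also have "\<dots> = (\<Prod>p\<in>prime_factors m. p ^ ex p)"
    by (rule prod.cong) (use ex_pos power_minus_mult in blast)+
  finally show ?thesis
    using m_eq_prod by simp
qed

lemma Q_pos: "Q > 0"
  using m_pos m_eq by (cases "Q = 0") auto

lemma power_dvd_Q: "q \<in> prime_factors m \<Longrightarrow> q ^ (ex q - 1) dvd Q"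
  unfolding Q_def by (rule dvd_prodI) auto

lemma SD:
  assumes "p \<in> S"
  shows "prime p" "odd p" "p \<ge> 3" "p \<in> prime_factors m" "ex p = 1" "s p = p + 1"
proof -
  show p: "prime p" and "p \<in> prime_factors m" and e: "ex p = 1"
    using assms by (auto simp: S_def)
  have "p \<noteq> 2"
    using assms by (simp add: S_def)
  then show "odd p" "p \<ge> 3"
    using p prime_ge_2_nat[OF p] primes_dvd_imp_eq[of 2 p] by auto
  show "s p = p + 1"
    using e sigma_prime_power[OF p, of 1] by (simp add: s_def)
qed

lemma AD:
  assumes "q \<in> A"
  shows "prime q" "q \<ge> 2" "q \<in> prime_factors m" "ex q \<ge> 2" "q dvd Q"
proof -
  show "prime q" and q: "q \<in> prime_factors m" and e: "ex q \<ge> 2"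
    using assms by (auto simp: A_def)
  then show "q \<ge> 2"
    by (simp add: prime_ge_2_nat)
  have "q dvd q ^ (ex q - 1)"
    using e by (intro dvd_power) auto
  then show "q dvd Q"
    using power_dvd_Q[OF q] by (rule dvd_trans)
qed

lemma finite_S: "finite S"
  by (simp add: S_def)

section \<open>Reduction to an upper bound for the product over \<open>S\<close>\<close>

lemma card_S_le: "card S \<le> N"
proof -
  have "(\<Prod>p\<in>S. 2) dvd (\<Prod>p\<in>S. s p)"
    by (rule prod_dvd_prod) (use SD in auto)
  also have "\<dots> dvd sigma m"
    unfolding sigma_m_eq_prod by (rule prod_dvd_prod_subset) (auto simp: S_def)
  finally have "2 ^ card S dvd sigma m"
    by simp
  then show ?thesis
    using val_sigma le_imp_power_dvd[of "Suc N" "card S" 2] dvd_trans not_less_eq_eq by blast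
qed

lemma N_pos: "N > 0"
proof (rule ccontr)
  assume "\<not> N > 0"
  then show False
    using val_sigma even_m sigma_m by simp
qed

lemma prime_factors_eq: "prime_factors m = insert 2 (S \<union> A)"
  using two_in ex_pos by (fastforce simp: S_def A_def)

text \<open>Each \<open>p\<close> in \<open>A\<close> is at most \<open>p ^ (ex p - 1)\<close>, its
  share of \<open>Q\<close>. The factor 2 accounts for the prime 2 when its exponent is 1: it then
  lies in neither \<open>S\<close> nor \<open>A\<close>.\<close>

lemma rad_le: "rad m \<le> (if ex 2 = 1 then 2 else 1) * (\<Prod>p\<in>S. p) * Q"
proof -
  have AQ: "(\<Prod>p\<in>A. p) \<le> Q"
  proof -
    have "(\<Prod>p\<in>A. p) \<le> (\<Prod>p\<in>A. p ^ (ex p - 1))"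
    proof (rule prod_mono)
      fix p assume "p \<in> A"
      then show "0 \<le> p \<and> p \<le> p ^ (ex p - 1)"
        using power_increasing[of 1 "ex p - 1" p] AD(2,4)[of p] by simp
    qed
    also have "\<dots> \<le> Q"
      unfolding Q_def
      by (rule dvd_imp_le[OF prod_dvd_prod_subset]) (use Q_pos in \<open>auto simp: A_def Q_def\<close>)
    finally show ?thesis .
  qed
  have fin: "finite A" "finite S" and disj: "S \<inter> A = {}"
    by (auto simp: A_def S_def)
  have "rad m = (if ex 2 = 1 then 2 else 1) * (\<Prod>p\<in>S \<union> A. p)"
  proof (cases "ex 2 = 1")
    case True
    then have "2 \<notin> S \<union> A"
      by (auto simp: A_def S_def)
    then show ?thesis
      using True fin unfolding rad_def by (simp add: prime_factors_eq)
  next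
    case False
    then have "2 \<in> A"
      using two_in ex_pos[of 2] by (auto simp: A_def)
    then show ?thesis
      using False unfolding rad_def prime_factors_eq by (simp add: insert_absorb)
  qed
  also have "(\<Prod>p\<in>S \<union> A. p) = (\<Prod>p\<in>S. p) * (\<Prod>p\<in>A. p)"
    using fin disj by (rule_tac prod.union_disjoint)
  finally show ?thesis
    using AQ by simp
qed

lemma rad_less_of_prod_S_less:
  assumes "(if ex 2 = 1 then 2 else 1) * (\<Prod>p\<in>S. p) < (Q\<^sup>2) ^ N"
  shows "rad m < Q ^ (2 * N + 1)"
proof -
  have "rad m \<le> (if ex 2 = 1 then 2 else 1) * (\<Prod>p\<in>S. p) * Q"
    by (rule rad_le)
  also have "\<dots> < (Q\<^sup>2) ^ N * Q"
    using assms Q_pos by (rule mult_strict_right_mono)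
  also have "\<dots> = Q ^ (2 * N + 1)"
    by (simp only: power_mult power_add power_one_right)
  finally show ?thesis .
qed

section \<open>Tracing each prime of \<open>S\<close> to a factor of \<open>sigma m\<close>\<close>

lemma source:
  assumes "p \<in> S"
  obtains (single) q where "q \<in> S" "2 * p dvd q + 1" "p < q"
  | (two) "p dvd 2 ^ (ex 2 + 1) - 1"
  | (multiple) q where "q \<in> A" "odd q" "p dvd s q"
proof -
  note p = SD[OF assms]
  have "p dvd (\<Prod>q\<in>prime_factors m. s q)"
    unfolding sigma_m_eq_prod[symmetric] sigma_m using p(4) by auto
  then obtain q where q: "q \<in> prime_factors m" "p dvd s q"
    using p(1) prime_dvd_prod_iff[of "prime_factors m" p s] by auto
  show thesis
  proof (cases "q = 2")
    case True
    have "s 2 = 2 ^ (ex 2 + 1) - 1"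
      unfolding s_def by (rule sigma_two_power)
    then show thesis
      using q True two by simp
  next
    case False
    show thesis
    proof (cases "q \<in> S")
      case True
      note q' = SD[OF this]
      \<comment> \<open>Here \<open>s q = q + 1\<close> is even while \<open>p\<close> is odd, which
        supplies the factor 2. The case \<open>single\<close> records divisibility because later
        arguments use more than the inequality.\<close>
      have "p dvd q + 1" "2 dvd q + 1" "coprime 2 p"
        using q q' p by auto
      then have d: "2 * p dvd q + 1"
        by (simp add: divides_mult)
      then have "2 * p \<le> q + 1"
        by (rule dvd_imp_le) simp
      then show thesis
        using single[OF True d] p(3) by simp
    next
      case nS: False
      then have "q \<in> A"
        using q(1) False prime_factors_eq by auto
      moreover have "odd q"
        using False primeI[OF q(1)] primes_dvd_imp_eq[of 2 q] by auto
      ultimately show thesis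
        using multiple q by blast
    qed
  qed
qed

text \<open>The case \<open>single\<close> of \<open>source\<close> passes from \<open>p\<close> to
  a larger element of the finite set \<open>S\<close>, so facts about \<open>S\<close> are proved
  from its maximum downwards.\<close>

lemma S_descent_induct [consumes 1, case_names step]:
  assumes "p \<in> S" "\<And>p. p \<in> S \<Longrightarrow> (\<And>q. q \<in> S \<Longrightarrow> p < q \<Longrightarrow> P q) \<Longrightarrow> P p"
  shows "P p"
  using assms(1)
proof (induction "Max S - p" arbitrary: p rule: less_induct)
  case less
  show ?case
  proof (rule assms(2)[OF less.prems])
    fix q assume "q \<in> S" "p < q"
    moreover have "q \<le> Max S"
      using \<open>q \<in> S\<close> finite_S by simp
    ultimately show "P q"
      by (intro less.hyps) auto
  qed
qed

text \<open>For exponent 1 or 2 the value \<open>s 2\<close> is the Mersenne prime 3 or 7. With no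
  odd prime in \<open>A\<close>, every chain in \<open>S\<close> ends at this prime
  \<open>M\<close>; since \<open>M + 1\<close> is a power of 2, no smaller element leads to
  \<open>M\<close>. So \<open>m\<close> is a power of 2 or the perfect number 6 or 28, against
  \<open>k > 2\<close>.\<close>

lemma exists_odd_in_A:
  assumes "ex 2 \<le> 2"
  shows "\<exists>q\<in>A. odd q"
proof (rule ccontr)
  assume no: "\<not> (\<exists>q\<in>A. odd q)"
  define M :: nat where "M = 2 ^ (ex 2 + 1) - 1"
  have ex2: "ex 2 = 1 \<or> ex 2 = 2"
    using assms ex_pos[OF two_in] by linarith
  have prime_M: "prime M"
    using ex2 by (auto simp: M_def)
  have "p = M" if "p \<in> S" for p
    using that
  proof (induction p rule: S_descent_induct)
    case (step p)
    note p = SD[OF step(1)]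
    from step(1) show ?case
    proof (cases rule: source)
      case (single q)
      then have "p dvd M + 1"
        using step(2) by (metis dvd_mult_right)
      then have "p dvd 2 ^ (ex 2 + 1)"
        by (simp add: M_def)
      then have "p dvd 2"
        using p(1) prime_dvd_power by blast
      then show ?thesis
        using p(3) by (auto dest: dvd_imp_le)
    next
      case two
      then show ?thesis
        using p(1) prime_M primes_dvd_imp_eq unfolding M_def by blast
    next
      case (multiple q)
      then show ?thesis
        using no by blast
    qed
  qed
  then have S: "S = {} \<or> S = {M}"
    by blast
  have "q = 2" if "q \<in> A" for q
    using that no primes_dvd_imp_eq[of 2 q] by (auto simp: A_def)
  then have pf: "prime_factors m = insert 2 S"
    using prime_factors_eq by blast
  have two_S: "2 \<notin> S"
    by (simp add: S_def)
  have m: "m = 2 ^ ex 2 * (\<Prod>p\<in>S. p)"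
  proof -
    have "m = 2 ^ ex 2 * (\<Prod>p\<in>S. p ^ ex p)"
      using m_eq_prod pf two_S finite_S by simp
    then show ?thesis
      using SD(5) by simp
  qed
  have s2: "s 2 = M"
    by (simp add: s_def sigma_two_power M_def)
  have "sigma m = M * (\<Prod>p\<in>S. s p)"
    using sigma_m_eq_prod pf two_S finite_S s2 by simp
  also have "(\<Prod>p\<in>S. s p) = (\<Prod>p\<in>S. p + 1)"
    by (rule prod.cong) (use SD(6) in auto)
  finally have "sigma m \<le> 2 * m"
    using S m ex2 by (auto simp: M_def)
  then show False
    using sigma_m k_gt_2 m_pos by simp
qed

section \<open>The case of exponent at least 2 at the prime 2\<close>

lemma rad_less_of_ex2_ge_2:
  assumes "ex 2 \<ge> 2"
  shows "rad m < Q ^ (2 * N + 1)"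
proof -
  have two_pow_Q: "2 ^ (ex 2 - 1) dvd Q"
    using power_dvd_Q two_in by blast
  \<comment> \<open>As \<open>Q\<close> is even, an odd prime power in it comes with an extra factor
    2. Squared, this absorbs the 2 from \<open>sigma_prime_power_less\<close>.\<close>
  have both: "2 * q ^ (ex q - 1) \<le> Q" if "q \<in> A" "odd q" for q
  proof -
    have "2 dvd Q"
      using two_pow_Q assms dvd_power[of "ex 2 - 1" 2] dvd_trans by fastforce
    moreover have "q ^ (ex q - 1) dvd Q"
      using that power_dvd_Q by (auto simp: A_def)
    ultimately have "2 * q ^ (ex q - 1) dvd Q"
      using that by (intro divides_mult) auto
    then show ?thesis
      using Q_pos by (rule dvd_imp_le)
  qed
  \<comment> \<open>For the exponent e of 2, e + 1 \<le> 2(e - 1) holds only from e = 3 on; for e =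
    2 an odd prime in \<open>A\<close> makes up the deficit.\<close>
  have two_bound: "2 ^ (ex 2 + 1) \<le> Q\<^sup>2"
  proof (cases "ex 2 = 2")
    case True
    then obtain q where q: "q \<in> A" "odd q"
      using exists_odd_in_A by auto
    have "q ^ 1 \<le> q ^ (ex q - 1)"
      by (rule power_increasing) (use AD(2,4)[OF q(1)] in auto)
    moreover have "q \<ge> 2"
      using AD(2) q by blast
    ultimately have "Q \<ge> 4"
      using both[OF q] by simp
    then show ?thesis
      using True power_mono[of 4 Q 2] by simp
  next
    case False
    then have "(2::nat) ^ (ex 2 + 1) \<le> 2 ^ (2 * (ex 2 - 1))"
      using assms by (intro power_increasing) auto
    also have "\<dots> = (2 ^ (ex 2 - 1))\<^sup>2"
      by (simp add: power_mult[symmetric] mult.commute)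
    also have "\<dots> \<le> Q\<^sup>2"
      by (rule power_mono) (use two_pow_Q Q_pos dvd_imp_le in auto)
    finally show ?thesis .
  qed
  have less: "p < Q\<^sup>2" if "p \<in> S" for p
    using that
  proof (induction p rule: S_descent_induct)
    case (step p)
    from step(1) show ?case
    proof (cases rule: source)
      case (single q)
      then show ?thesis
        using step(2) by force
    next
      case two
      moreover have "(1::nat) < 2 ^ (ex 2 + 1)"
        by (rule one_less_power) auto
      ultimately have "p \<le> 2 ^ (ex 2 + 1) - 1"
        by (intro dvd_imp_le) auto
      also have "\<dots> < 2 ^ (ex 2 + 1)"
        by simp
      finally show ?thesis
        using two_bound by simp
    next
      case (multiple q)
      have q: "prime q" "ex q \<ge> 2"
        using multiple by (auto simp: A_def)
      have "s q > 0"
        using q prime_gt_0_nat[of q] by (simp add: s_def sigma_prime_power sum_pos)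
      with multiple have "p \<le> s q"
        by (auto intro: dvd_imp_le)
      also have "\<dots> < 2 * q ^ ex q"
        unfolding s_def using q by (intro sigma_prime_power_less)
      also have "\<dots> \<le> 4 * q ^ (2 * (ex q - 1))"
      proof -
        have "q ^ ex q \<le> q ^ (2 * (ex q - 1))"
          using q prime_ge_1_nat[of q] by (intro power_increasing) auto
        then show ?thesis by linarith
      qed
      also have "\<dots> = (2 * q ^ (ex q - 1))\<^sup>2"
        by (simp add: power_mult_distrib power_mult[symmetric] mult.commute)
      also have "\<dots> \<le> Q\<^sup>2"
        using both multiple by (intro power_mono) auto
      finally show ?thesis .
    qed
  qed
  have Q2: "Q\<^sup>2 \<ge> 2"
    using two_bound by (rule order_trans[rotated]) simp
  \<comment> \<open>Lowering the base to \<open>Q\<^sup>2 - 1\<close> keeps the final inequality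
    strict even if \<open>S\<close> is empty, since \<open>N\<close> is positive.\<close>
  have "(\<Prod>p\<in>S. p) \<le> (\<Prod>p\<in>S. Q\<^sup>2 - 1)"
    by (rule prod_mono) (use less in force)
  also have "\<dots> = (Q\<^sup>2 - 1) ^ card S"
    by simp
  also have "\<dots> \<le> (Q\<^sup>2 - 1) ^ N"
    using card_S_le Q2 by (intro power_increasing) auto
  also have "\<dots> < (Q\<^sup>2) ^ N"
    using N_pos Q2 by (intro power_strict_mono) auto
  finally show ?thesis
    using rad_less_of_prod_S_less assms by simp
qed

section \<open>The case of exponent 1 at the prime 2\<close>

lemma Q_ge_3:
  assumes "ex 2 = 1"
  shows "Q \<ge> 3"
proof -
  obtain q where q: "q \<in> A" "odd q"
    using exists_odd_in_A assms by auto
  then have "q \<ge> 3"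
    using AD(2)[OF q(1)] by (cases "q = 2") auto
  moreover have "q \<le> Q"
    using AD(5)[OF q(1)] Q_pos by (rule dvd_imp_le)
  ultimately show ?thesis
    by simp
qed

lemma odd_Q:
  assumes "ex 2 = 1"
  shows "odd Q"
proof -
  have "odd (p ^ (ex p - 1))" if "p \<in> prime_factors m" for p
    using that assms primes_dvd_imp_eq[of 2 p] by (cases "p = 2") auto
  then show ?thesis
    unfolding Q_def by (simp add: even_prod_iff)
qed

text \<open>The factor 2 pays for the one in \<open>rad_le\<close>. Exponents of \<open>q\<close>
  from 3 on leave enough room. For exponent 2, the cofactor of \<open>p\<close> in the odd number
  \<open>q\<^sup>2 + q + 1\<close> is 1 or at least 3; if it is 1, excluding the exceptional case
  forces \<open>Q\<close> to be at least \<open>2 * q\<close>.\<close>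

lemma S_le_half_Q_square:
  assumes "ex 2 = 1" "\<not> (Q \<in> A \<and> ex Q = 2 \<and> Q\<^sup>2 + Q + 1 \<in> S)" "p \<in> S"
  shows "2 * p \<le> Q\<^sup>2"
  using assms(3)
proof (induction p rule: S_descent_induct)
  case (step p)
  from step(1) show ?case
  proof (cases rule: source)
    case (single q)
    then show ?thesis
      using step(2) by force
  next
    case two
    then have "p \<le> 3"
      using assms(1) by (auto dest: dvd_imp_le)
    then show ?thesis
      using power_mono[OF Q_ge_3[OF assms(1)], of 2] by simp
  next
    case (multiple q)
    note q = AD[OF multiple(1)]
    have q3: "q \<ge> 3"
      using q(2) multiple(2) by (cases "q = 2") auto
    show ?thesis
    proof (cases "ex q = 2")
      case False
      have "s q > 0"
        using q by (simp add: s_def sigma_prime_power sum_pos)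
      with multiple have "2 * p \<le> 2 * s q"
        by (auto intro: dvd_imp_le)
      also have "\<dots> \<le> 3 * q ^ ex q"
        unfolding s_def using sigma_odd_prime_power_less[OF q(1) q3, of "ex q"] by simp
      also have "\<dots> \<le> q ^ (ex q + 1)"
        using q3 by simp
      also have "\<dots> \<le> q ^ (2 * (ex q - 1))"
        using q False by (intro power_increasing) auto
      also have "\<dots> = (q ^ (ex q - 1))\<^sup>2"
        by (simp add: power_mult[symmetric] mult.commute)
      also have "\<dots> \<le> Q\<^sup>2"
        using power_dvd_Q[OF q(3)] Q_pos by (intro power_mono dvd_imp_le) auto
      finally show ?thesis .
    next
      case True
      have sq: "s q = q\<^sup>2 + q + 1"
        using True q(1) by (simp add: s_def sigma_prime_square)
      have qq: "3 * q \<le> q\<^sup>2"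
        using q3 by (simp add: power2_eq_square)
      obtain c where c: "q\<^sup>2 + q + 1 = p * c"
        using multiple(3) sq by auto
      obtain d where d: "Q = q * d"
        using q(5) by auto
      have "odd (q\<^sup>2 + q + 1)"
        using multiple(2) by simp
      then have "odd c"
        using c by (metis even_mult_iff)
      then consider "c = 1" | "c \<ge> 3"
        by (cases "c = 0"; cases "c = 2") (auto, linarith)
      then show ?thesis
      proof cases
        case 1
        have "d \<noteq> 1"
        proof
          assume "d = 1"
          then show False
            using assms(2) True d c 1 multiple(1) step(1) by simp
        qed
        then have "d \<ge> 2"
          using Q_pos d by (cases "d = 0") auto
        then have "(q * 2)\<^sup>2 \<le> Q\<^sup>2"
          unfolding d by (intro power_mono mult_left_mono) auto
        then show ?thesis
          using c 1 qq q3 by (simp add: power_mult_distrib)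
      next
        case 2
        have "p * 3 \<le> p * c"
          using 2 by simp
        then have "2 * p \<le> q\<^sup>2"
          using c qq q3 by linarith
        also have "\<dots> \<le> Q\<^sup>2"
          using q(5) Q_pos by (intro power_mono dvd_imp_le) auto
        finally show ?thesis .
      qed
    qed
  qed
qed

text \<open>Halving all \<open>N\<close> factors gains \<open>2 ^ N\<close>, and one factor 2 is
  enough because \<open>N\<close> is positive. Since \<open>Q\<^sup>2\<close> is odd, each element
  is at most \<open>B\<close>, whose double is strictly below \<open>Q\<^sup>2\<close>.\<close>

lemma rad_less_of_S_le_half:
  assumes "ex 2 = 1" "\<And>p. p \<in> S \<Longrightarrow> 2 * p \<le> Q\<^sup>2"
  shows "rad m < Q ^ (2 * N + 1)"
proof -
  define B where "B = (Q\<^sup>2 - 1) div 2"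
  have Q9: "Q\<^sup>2 \<ge> 9"
    using power_mono[OF Q_ge_3[OF assms(1)], of 2] by simp
  have odd: "odd (Q\<^sup>2)"
    using odd_Q assms(1) by simp
  then have B: "2 * B < Q\<^sup>2" "B \<ge> 1"
    using Q9 unfolding B_def by presburger+
  have "p \<le> B" if "p \<in> S" for p
    using assms(2)[OF that] odd unfolding B_def by presburger
  then have "(\<Prod>p\<in>S. p) \<le> (\<Prod>p\<in>S. B)"
    by (intro prod_mono) auto
  also have "\<dots> \<le> B ^ N"
    using card_S_le B by (simp add: power_increasing)
  finally have "2 * (\<Prod>p\<in>S. p) \<le> 2 ^ 1 * B ^ N"
    by simp
  also have "\<dots> \<le> 2 ^ N * B ^ N"
    using N_pos by (intro mult_right_mono power_increasing) auto
  also have "\<dots> = (2 * B) ^ N"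
    by (simp add: power_mult_distrib)
  also have "\<dots> < (Q\<^sup>2) ^ N"
    using B N_pos by (intro power_strict_mono) auto
  finally show ?thesis
    using rad_less_of_prod_S_less assms(1) by simp
qed

text \<open>The prime \<open>Q\<close> is the only element of \<open>A\<close>. An element of
  \<open>S\<close> of size about P/4 or less offsets both the excess of \<open>P\<close> over
  \<open>Q\<^sup>2\<close> and the factor 2. Without such an element \<open>m\<close> is explicit
  enough to show \<open>sigma m < 3 * m\<close>.\<close>

lemma rad_less_of_exceptional:
  assumes ex2: "ex 2 = 1" and Q: "Q \<in> A" "ex Q = 2" and P_def: "P = Q\<^sup>2 + Q + 1" and P: "P \<in> S"
  shows "rad m < Q ^ (2 * N + 1)"
proof -
  note Q3 = Q_ge_3[OF ex2]
  have QQ: "3 * Q \<le> Q\<^sup>2"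
    using Q3 by (simp add: power2_eq_square)
  have A_eq: "A = {Q}"
    using AD(1,5) Q(1) primes_dvd_imp_eq by blast
  have sQ: "s Q = P"
    using Q AD(1) by (simp add: s_def sigma_prime_square P_def)
  \<comment> \<open>Chains in \<open>S\<close> end at \<open>P\<close> or at 3, the value of
    \<open>s 2\<close>. One step below \<open>P\<close>, \<open>2 * p\<close> divides
    \<open>P + 1\<close> with quotient 1 or at least 2; two halvings give
    \<open>4 * p \<le> P + 3\<close>.\<close>
  have bound: "2 * p = P + 1 \<or> 4 * p \<le> P + 3" if "p \<in> S" "p \<noteq> P" for p
    using that
  proof (induction p rule: S_descent_induct)
    case (step p)
    from step(1) show ?case
    proof (cases rule: source)
      case (single q)
      then obtain c where c: "q + 1 = 2 * p * c"
        by auto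
      then have "c \<noteq> 0"
        by (cases "c = 0") auto
      show ?thesis
      proof (cases "q = P")
        case True
        have "4 * p \<le> P + 3" if "c \<noteq> 1"
        proof -
          have "2 * p * 2 \<le> 2 * p * c"
            using that \<open>c \<noteq> 0\<close> by (intro mult_le_mono2) simp
          then show ?thesis
            using c True by linarith
        qed
        then show ?thesis
          using c True by (cases "c = 1") auto
      next
        case False
        then have "2 * q \<le> P + 1"
          using step(2)[OF single(1,3)] P_def by auto
        moreover have "2 * p \<le> q + 1"
          using c \<open>c \<noteq> 0\<close> by simp
        ultimately show ?thesis
          by simp
      qed
    next
      case two
      then have "p \<le> 3"
        using ex2 by (auto dest: dvd_imp_le)
      then show ?thesis
        using P_def QQ Q3 by simp
    next
      case (multiple q)
      then have "p dvd P"
        using A_eq sQ by simp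
      then show ?thesis
        using SD(1) step P primes_dvd_imp_eq by blast
    qed
  qed
  have two_prod: "2 * (\<Prod>p\<in>S. p) < (Q\<^sup>2) ^ N"
  proof (cases "\<exists>r\<in>S. r \<noteq> P \<and> 2 * r \<noteq> P + 1")
    case True
    then obtain r where r: "r \<in> S" "r \<noteq> P" "4 * r \<le> P + 3"
      using bound by blast
    \<comment> \<open>For \<open>Q = 3\<close> the bound with \<open>P = 13\<close> forces
      \<open>r = 3\<close>, but 3 then has exponent 2 and cannot lie in \<open>S\<close>.\<close>
    have "Q \<noteq> 3"
    proof
      assume "Q = 3"
      then have "r = Q"
        using r SD(2,3)[OF r(1)] P_def by (cases "r = 4") auto
      then show False
        using Q(2) SD(5)[OF r(1)] by simp
    qed
    moreover have "Q \<noteq> 4"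
      using odd_Q[OF ex2] by auto
    ultimately have "Q \<ge> 5"
      using Q3 by simp
    then have Q5: "5 * Q \<le> Q\<^sup>2"
      by (simp add: power2_eq_square)
    \<comment> \<open>The constants come from the extreme case \<open>Q = 5\<close>, where
      \<open>P = 31\<close>, \<open>Q\<^sup>2 = 25\<close> and (P + 3)/4 = 34/4. They suffice
      because 2 * 31 * 34 < 2500.\<close>
    have "25 * P \<le> 31 * Q\<^sup>2"
      using Q5 \<open>Q \<ge> 5\<close> by (simp add: P_def)
    moreover have "100 * r \<le> 34 * Q\<^sup>2"
      using Q5 \<open>Q \<ge> 5\<close> r(3) by (simp add: P_def)
    ultimately have "(25 * P) * (100 * r) \<le> (31 * Q\<^sup>2) * (34 * Q\<^sup>2)"
      by (rule mult_le_mono)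
    moreover have "Q\<^sup>2 * Q\<^sup>2 > 0"
      using Q_pos by simp
    ultimately have Pr: "2 * (P * r) < Q\<^sup>2 * Q\<^sup>2"
      by linarith
    define X where "X = S - {P, r}"
    have X: "S = insert P (insert r X)" "finite X" "P \<notin> insert r X" "r \<notin> X"
      using r P finite_S by (auto simp: X_def)
    have "p \<le> Q\<^sup>2" if "p \<in> X" for p
      using bound[of p] that QQ Q3 unfolding X_def P_def by auto
    then have "(\<Prod>p\<in>X. p) \<le> (\<Prod>p\<in>X. Q\<^sup>2)"
      by (intro prod_mono) auto
    then have "(\<Prod>p\<in>X. p) \<le> (Q\<^sup>2) ^ card X"
      by simp
    then have "2 * (P * r) * (\<Prod>p\<in>X. p) \<le> 2 * (P * r) * (Q\<^sup>2) ^ card X"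
      by (rule mult_le_mono2)
    also have "\<dots> < Q\<^sup>2 * Q\<^sup>2 * (Q\<^sup>2) ^ card X"
      using Pr Q_pos by (intro mult_strict_right_mono) auto
    also have "\<dots> = (Q\<^sup>2) ^ card S"
      using X by simp
    also have "\<dots> \<le> (Q\<^sup>2) ^ N"
      using card_S_le Q_pos by (intro power_increasing) auto
    also have "2 * (P * r) * (\<Prod>p\<in>X. p) = 2 * (\<Prod>p\<in>S. p)"
      using X by simp
    finally show ?thesis .
  next
    case False
    have "2 \<notin> insert Q S" "Q \<notin> S"
      using ex2 Q Q3 by (auto simp: S_def)
    moreover have "prime_factors m = insert 2 (insert Q S)"
      using prime_factors_eq A_eq by simp
    ultimately have pf: "(\<Prod>p\<in>prime_factors m. f p) = f 2 * (f Q * (\<Prod>p\<in>S. f p))" for f :: "nat \<Rightarrow> nat"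
      using finite_S by simp
    have "s 2 = 3"
      using ex2 sigma_two_power[of 1] by (simp add: s_def)
    then have "sigma m = 3 * (P * (\<Prod>p\<in>S. s p))"
      using sigma_m_eq_prod sQ by (simp add: pf)
    also have "(\<Prod>p\<in>S. s p) = (\<Prod>p\<in>S. p + 1)"
      by (rule prod.cong) (use SD(6) in auto)
    finally have sig: "sigma m = 3 * (P * (\<Prod>p\<in>S. p + 1))" .
    have "m = 2 * (Q\<^sup>2 * (\<Prod>p\<in>S. p ^ ex p))"
      using m_eq_prod ex2 Q(2) by (simp add: pf)
    also have "(\<Prod>p\<in>S. p ^ ex p) = (\<Prod>p\<in>S. p)"
      by (rule prod.cong) (use SD(5) in auto)
    finally have m: "m = 2 * (Q\<^sup>2 * (\<Prod>p\<in>S. p))" .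
    have "3 * m \<le> sigma m"
      using sigma_m k_gt_2 by simp
    then have le: "2 * Q\<^sup>2 * (\<Prod>p\<in>S. p) \<le> P * (\<Prod>p\<in>S. p + 1)"
      unfolding sig using m by simp
    have P_pos: "P > 0"
      by (simp add: P_def)
    \<comment> \<open>Every other element of \<open>S\<close> equals (P + 1)/2. In the two cases
      \<open>le\<close> reduces to \<open>Q\<^sup>2 \<le> Q + 2\<close> and
      \<open>Q\<^sup>2 \<le> Q + 4\<close>, both false for \<open>Q \<ge> 3\<close>.\<close>
    consider "S = {P}" | r where "S = {P, r}" "r \<noteq> P" "2 * r = P + 1"
    proof (cases "S = {P}")
      case ne: False
      then obtain r where r: "r \<in> S" "r \<noteq> P"
        using P by blast
      then have "2 * r = P + 1"
        using False by blast
      moreover have "q = P \<or> q = r" if "q \<in> S" for q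
      proof -
        have "q = P \<or> 2 * q = P + 1"
          using False that by blast
        then show ?thesis
          using \<open>2 * r = P + 1\<close> by linarith
      qed
      ultimately show ?thesis
        using that(2)[of r] r P by blast
    qed (use that in blast)
    then have False
    proof cases
      case 1
      have "P * (2 * Q\<^sup>2) \<le> P * (P + 1)"
        using le unfolding 1 by (simp add: mult_ac)
      then have "2 * Q\<^sup>2 \<le> P + 1"
        using P_pos by (rule mult_left_le_imp_le)
      then show False
        using QQ Q3 P_def by simp
    next
      case 2
      have "P * r * (2 * Q\<^sup>2) \<le> P * ((P + 1) * (r + 1))"
        using le 2(2) unfolding 2(1) by (simp add: mult_ac)
      also have "\<dots> = P * r * (2 * (r + 1))"
        unfolding 2(3)[symmetric] by (simp add: algebra_simps)
      finally have "P * r * (2 * Q\<^sup>2) \<le> P * r * (2 * (r + 1))" .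
      moreover have "P * r > 0"
        using P_pos SD(3)[of r] 2(1) by simp
      ultimately have "2 * Q\<^sup>2 \<le> 2 * (r + 1)"
        by (rule mult_left_le_imp_le)
      then show False
        using QQ Q3 P_def 2(3) by simp
    qed
    then show ?thesis ..
  qed
  then show ?thesis
    using rad_less_of_prod_S_less ex2 by simp
qed

section \<open>Combining the cases and passing to the real exponent\<close>

lemma rad_less: "rad m < Q ^ (2 * N + 1)"
proof (cases "ex 2 = 1")
  case True
  then show ?thesis
    using rad_less_of_exceptional[OF True _ _ refl] rad_less_of_S_le_half[OF True]
      S_le_half_Q_square[OF True] by blast
next
  case False
  then show ?thesis
    using rad_less_of_ex2_ge_2 ex_pos[OF two_in] by simp
qed

text \<open>Multiplying \<open>rad_less\<close> by \<open>rad m ^ (2 * N + 1)\<close> turns the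
  power of \<open>Q\<close> into one of \<open>m = Q * rad m\<close>.\<close>

lemma rad_power_less: "rad m ^ (2 * N + 2) < m ^ (2 * N + 1)"
proof -
  have "rad m > 0"
    using m_pos m_eq by (cases "rad m = 0") auto
  then have "rad m * rad m ^ (2 * N + 1) < Q ^ (2 * N + 1) * rad m ^ (2 * N + 1)"
    using rad_less by (intro mult_strict_right_mono) auto
  also have "\<dots> = m ^ (2 * N + 1)"
    by (subst (3) m_eq) (rule power_mult_distrib[symmetric])
  finally show ?thesis
    by simp
qed

end

theorem theorem2:
  fixes m k n t \<alpha> h :: nat
  assumes "m > 0" and "even m"
    and "k > 2" and "sigma m = k * m"
    and "k = 2 ^ n * t" and "odd t"
    and "m = 2 ^ \<alpha> * h" and "odd h" and "\<alpha> \<ge> 1"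
  shows "real (rad m) < real m powr ((2 * real n + 2 * real \<alpha> + 1) / (2 * real n + 2 * real \<alpha> + 2))"
proof -
  define N where "N = n + \<alpha>"
  have "sigma m = 2 ^ N * (t * h)"
    using assms by (simp add: N_def power_add mult_ac)
  then have "\<not> 2 ^ Suc N dvd sigma m"
    using assms by simp
  then interpret even_multiperfect m k N
    using assms by unfold_locales
  \<comment> \<open>The target exponent is (M - 1)/M, so the integer inequality yields the claim on
    taking \<open>M\<close>-th roots.\<close>
  define M where "M = 2 * N + 2"
  have "real (rad m) ^ M < real m ^ (M - 1)"
    using rad_power_less unfolding M_def of_nat_power[symmetric] of_nat_less_iff by simp
  also have "\<dots> = (real m powr (real (M - 1) / real M)) ^ M"
    using m_pos powr_realpow[of "real m" "M - 1"] powr_power[of "real m" "real (M - 1) / real M" M]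
    by (simp add: M_def)
  finally have "real (rad m) < real m powr (real (M - 1) / real M)"
    by (rule power_less_imp_less_base) simp
  moreover have "real (M - 1) / real M = (2 * real n + 2 * real \<alpha> + 1) / (2 * real n + 2 * real \<alpha> + 2)"
    by (simp add: M_def N_def algebra_simps)
  ultimately show ?thesis
    by simp
qed

end
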